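(* Let $\mathcal{R}$ be a Borel equivalence relation with countable classes on a standard Borel space $X$ and let $\mathcal{A}$ be a Borel $\mathcal{R}$-field of graphs on $X$. Suppose that the space of oriented edges $\mathcal{A}^{1+}$ is a homogeneous $\mathcal{R}$-fibred standard space, and let $s:B\to\mathcal{A}^{1+}$ be a saturating partial section defined on a Borel subset $B\subset X$. Suppose moreover that the saturations of the images of the partial sections of vertices $o(s)=o\circ s$ and $t(s)=t\circ s$ form an $\mathcal{R}$-invariant partition of the vertex space $\mathcal{A}^0$ into two pieces. Then the following assertions are equivalent: 1. $\mathcal{A}$ is an $\mathcal{R}$-arboretum; 2. $\mathcal{R}|_B$ is the amalgamated product of its sub-relations $\mathrm{Stab}_{\mathcal{R}}(o(s))$ and $\mathrm{Stab}_{\mathcal{R}}(t(s))$ over the sub-relation $\mathrm{Stab}_{\mathcal{R}}(s)$.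
   Context: Fibred spaces and actions. A fibred standard space over $X$ is a standard Borel space $F$ with a surjective Borel map $\pi:F\to X$ with countable preimages; $F_x=\pi^{-1}(x)$. An $\mathcal{R}$-action on $F$ (then $F$ is called an $\mathcal{R}$-fibred standard space) is a Borel map assigning to $(x,y)\in\mathcal{R}$ and $f\in F_y$ an element $(x,y)\cdot f\in F_x$, with $(y,y)\cdot f=f$ and $(x,y)\cdot((y,z)\cdot f)=(x,z)\cdot f$. It generates the Borel equivalence relation $\mathcal{R}_F$ on $F$: $f_x\in F_x$ and $f_y\in F_y$ are $\mathcal{R}_F$-equivalent iff $(x,y)\in\mathcal{R}$ and $(x,y)\cdot f_y=f_x$. A morphism of $\mathcal{R}$-fibred standard spaces is an equivariant fibre-preserving Borel map. A partial section is a Borel map $s:B\to F$, $B\subset X$ Borel, with $\pi\circ s=\mathrm{id}_B$; $\mathrm{Stab}_{\mathcal{R}}(s)$ is the sub-relation of $\mathcal{R}$ on $B$ for which $x,y$ are equivalent iff $(x,y)\in\mathcal R$ and $(y,x)\cdot s(x)=s(y)$. Saturations of subsets of $F$ are taken for $\mathcal{R}_F$. The partial section $s$ is saturating if the saturation of $s(B)$ is all of $F$; $F$ is homogeneous if it has a saturating partial section. Fields of graphs. Graphs are in the sense of Serre: edges $a$ have an origin $o(a)$, a terminal vertex $t(a)$ and an opposite edge $\bar a\neq a$, with $\bar{\bar a}=a$, $o(\bar a)=t(a)$. A Borel $\mathcal{R}$-field of graphs $\mathcal{A}$ on $X$ is a graph whose vertex space $\mathcal{A}^0$ and edge space $\mathcal{A}^1$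 are $\mathcal{R}$-fibred standard spaces over $X$ and for which $o,t:\mathcal{A}^1\to\mathcal{A}^0$ and $\bar{\ }:\mathcal{A}^1\to\mathcal{A}^1$ are morphisms of $\mathcal{R}$-fibred standard spaces. It is an $\mathcal{R}$-arboretum if the fibre $\mathcal{A}_x$ (a graph) is a tree for every $x\in X$. The space of oriented edges $\mathcal{A}^{1+}$ is an $\mathcal{R}$-invariant Borel subset of $\mathcal{A}^1$ containing exactly one edge of each pair $\{a,\bar a\}$ (an orientation). Amalgamated product. Let $\mathcal{Q}$ be generated by sub-relations $\mathcal{Q}_1,\mathcal{Q}_2$ and let $\mathcal{Q}_3$ be a common sub-relation of $\mathcal{Q}_1$ and $\mathcal{Q}_2$. For $n\ge2$ an $n$-tuple $(x_1,\dots,x_n)$ is reduced if there are $j_1,\dots,j_{n-1}\in\{1,2\}$ with $j_i\ne j_{i+1}$ and $(x_i,x_{i+1})\in\mathcal{Q}_{j_i}$ for all $i$, if no pair $(x_i,x_{i+1})$ lies in $\mathcal{Q}_3$ when $n>2$, and if $x_1\neq x_2$ when $n=2$. $\mathcal{Q}$ is the amalgamated product $\mathcal{Q}_1\star_{\mathcal{Q}_3}\mathcal{Q}_2$ if $x_n\ne x_1$ for every reduced $n$-tuple. *)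

theory Defs
  imports "HOL-Analysis.Analysis"
begin

text \<open>
  Borel spaces are represented by elements of the type of measures; only their underlying set and
  their sigma-algebra are ever used, never the values of the measure.
\<close>

definition standard_borel :: "'a measure \<Rightarrow> bool" where
  "standard_borel M \<longleftrightarrow>
     (\<exists>T. completely_metrizable_space T \<and> second_countable T \<and>
          space M = topspace T \<and> sets M = sigma_sets (topspace T) {U. openin T U})"

definition borel_equiv_rel :: "'x measure \<Rightarrow> ('x \<times> 'x) set \<Rightarrow> bool" where
  "borel_equiv_rel X R \<longleftrightarrow> R \<in> sets (X \<Otimes>\<^sub>M X) \<and> equiv (space X) R"

definition countable_classes :: "'x measure \<Rightarrow> ('x \<times> 'x) set \<Rightarrow> bool" where
  "countable_classes X R \<longleftrightarrow> (\<forall>x\<in>space X. countable (R `` {x}))"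

definition restrict_rel :: "('x \<times> 'x) set \<Rightarrow> 'x set \<Rightarrow> ('x \<times> 'x) set" where
  "restrict_rel R B = R \<inter> B \<times> B"

text \<open>
  \<open>fib_act F (x, y) f\<close> is the element \<open>(x, y) \<cdot> f\<close>; it is only meaningful when
  \<open>(x, y)\<close> is in the relation and \<open>f\<close> lies in the fibre over \<open>y\<close>.
\<close>

record ('x, 'f) fibred =
  fib_space :: "'f measure"
  fib_proj :: "'f \<Rightarrow> 'x"
  fib_act :: "'x \<times> 'x \<Rightarrow> 'f \<Rightarrow> 'f"

definition fibre :: "('x, 'f) fibred \<Rightarrow> 'x \<Rightarrow> 'f set" where
  "fibre F x = {f \<in> space (fib_space F). fib_proj F f = x}"

definition fibred_standard_space :: "'x measure \<Rightarrow> ('x, 'f) fibred \<Rightarrow> bool" where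
  "fibred_standard_space X F \<longleftrightarrow>
     standard_borel (fib_space F) \<and>
     fib_proj F \<in> fib_space F \<rightarrow>\<^sub>M X \<and>
     fib_proj F ` space (fib_space F) = space X \<and>
     (\<forall>x\<in>space X. countable (fibre F x))"

definition act_domain :: "('x \<times> 'x) set \<Rightarrow> ('x, 'f) fibred \<Rightarrow> (('x \<times> 'x) \<times> 'f) set" where
  "act_domain R F = {((x, y), f). (x, y) \<in> R \<and> f \<in> fibre F y}"

definition R_action :: "'x measure \<Rightarrow> ('x \<times> 'x) set \<Rightarrow> ('x, 'f) fibred \<Rightarrow> bool" where
  "R_action X R F \<longleftrightarrow>
     (\<lambda>(p, f). fib_act F p f) \<in>
        restrict_space ((X \<Otimes>\<^sub>M X) \<Otimes>\<^sub>M fib_space F) (act_domain R F) \<rightarrow>\<^sub>M fib_space F \<and>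
     (\<forall>x y f. (x, y) \<in> R \<longrightarrow> f \<in> fibre F y \<longrightarrow> fib_act F (x, y) f \<in> fibre F x) \<and>
     (\<forall>y\<in>space X. \<forall>f\<in>fibre F y. fib_act F (y, y) f = f) \<and>
     (\<forall>x y z f. (x, y) \<in> R \<longrightarrow> (y, z) \<in> R \<longrightarrow> f \<in> fibre F z \<longrightarrow>
        fib_act F (x, y) (fib_act F (y, z) f) = fib_act F (x, z) f)"

definition R_fibred_standard_space :: "'x measure \<Rightarrow> ('x \<times> 'x) set \<Rightarrow> ('x, 'f) fibred \<Rightarrow> bool" where
  "R_fibred_standard_space X R F \<longleftrightarrow> fibred_standard_space X F \<and> R_action X R F"

definition fib_rel :: "('x \<times> 'x) set \<Rightarrow> ('x, 'f) fibred \<Rightarrow> ('f \<times> 'f) set" where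
  "fib_rel R F =
     {(f, g). f \<in> space (fib_space F) \<and> g \<in> space (fib_space F) \<and>
        (fib_proj F f, fib_proj F g) \<in> R \<and> fib_act F (fib_proj F f, fib_proj F g) g = f}"

definition saturation :: "('x \<times> 'x) set \<Rightarrow> ('x, 'f) fibred \<Rightarrow> 'f set \<Rightarrow> 'f set" where
  "saturation R F S = {f. \<exists>g\<in>S. (f, g) \<in> fib_rel R F}"

definition R_invariant :: "('x \<times> 'x) set \<Rightarrow> ('x, 'f) fibred \<Rightarrow> 'f set \<Rightarrow> bool" where
  "R_invariant R F S \<longleftrightarrow> S \<subseteq> space (fib_space F) \<and> saturation R F S = S"

definition subfibred :: "('x, 'f) fibred \<Rightarrow> 'f set \<Rightarrow> ('x, 'f) fibred" where
  "subfibred F S = F\<lparr>fib_space := restrict_space (fib_space F) S\<rparr>"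

definition fibred_morphism ::
    "('x \<times> 'x) set \<Rightarrow> ('x, 'f) fibred \<Rightarrow> ('x, 'g) fibred \<Rightarrow> ('f \<Rightarrow> 'g) \<Rightarrow> bool" where
  "fibred_morphism R F G h \<longleftrightarrow>
     h \<in> fib_space F \<rightarrow>\<^sub>M fib_space G \<and>
     (\<forall>f\<in>space (fib_space F). fib_proj G (h f) = fib_proj F f) \<and>
     (\<forall>x y f. (x, y) \<in> R \<longrightarrow> f \<in> fibre F y \<longrightarrow> h (fib_act F (x, y) f) = fib_act G (x, y) (h f))"

definition partial_section :: "'x measure \<Rightarrow> ('x, 'f) fibred \<Rightarrow> 'x set \<Rightarrow> ('x \<Rightarrow> 'f) \<Rightarrow> bool" where
  "partial_section X F B s \<longleftrightarrow>
     B \<in> sets X \<and> s \<in> restrict_space X B \<rightarrow>\<^sub>M fib_space F \<and> (\<forall>x\<in>B. fib_proj F (s x) = x)"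

definition Stab ::
    "('x \<times> 'x) set \<Rightarrow> ('x, 'f) fibred \<Rightarrow> 'x set \<Rightarrow> ('x \<Rightarrow> 'f) \<Rightarrow> ('x \<times> 'x) set" where
  "Stab R F B s = {(x, y). x \<in> B \<and> y \<in> B \<and> (x, y) \<in> R \<and> fib_act F (y, x) (s x) = s y}"

definition saturating_section ::
    "'x measure \<Rightarrow> ('x \<times> 'x) set \<Rightarrow> ('x, 'f) fibred \<Rightarrow> 'x set \<Rightarrow> ('x \<Rightarrow> 'f) \<Rightarrow> bool" where
  "saturating_section X R F B s \<longleftrightarrow>
     partial_section X F B s \<and> saturation R F (s ` B) = space (fib_space F)"

definition homogeneous :: "'x measure \<Rightarrow> ('x \<times> 'x) set \<Rightarrow> ('x, 'f) fibred \<Rightarrow> bool" where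
  "homogeneous X R F \<longleftrightarrow>
     R_fibred_standard_space X R F \<and> (\<exists>B s. saturating_section X R F B s)"

definition invariant_bipartition ::
    "('x \<times> 'x) set \<Rightarrow> ('x, 'f) fibred \<Rightarrow> 'f set \<Rightarrow> 'f set \<Rightarrow> bool" where
  "invariant_bipartition R F P Q \<longleftrightarrow>
     R_invariant R F P \<and> R_invariant R F Q \<and> P \<inter> Q = {} \<and> P \<union> Q = space (fib_space F)"

record ('v, 'e) sgraph =
  verts :: "'v set"
  edges :: "'e set"
  org :: "'e \<Rightarrow> 'v"
  trm :: "'e \<Rightarrow> 'v"
  opp :: "'e \<Rightarrow> 'e"

definition serre_graph :: "('v, 'e) sgraph \<Rightarrow> bool" where
  "serre_graph G \<longleftrightarrow>
     (\<forall>a\<in>edges G. org G a \<in> verts G \<and> trm G a \<in> verts G \<and> opp G a \<in> edges G \<and>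
        opp G a \<noteq> a \<and> opp G (opp G a) = a \<and> org G (opp G a) = trm G a)"

definition edge_path :: "('v, 'e) sgraph \<Rightarrow> 'e list \<Rightarrow> bool" where
  "edge_path G p \<longleftrightarrow>
     set p \<subseteq> edges G \<and> (\<forall>i. Suc i < length p \<longrightarrow> trm G (p ! i) = org G (p ! Suc i))"

definition connected_graph :: "('v, 'e) sgraph \<Rightarrow> bool" where
  "connected_graph G \<longleftrightarrow>
     (\<forall>u\<in>verts G. \<forall>v\<in>verts G. u = v \<or>
        (\<exists>p. p \<noteq> [] \<and> edge_path G p \<and> org G (hd p) = u \<and> trm G (last p) = v))"

text \<open>
  A subgraph isomorphic to the \<open>n\<close>-cycle, \<open>n \<ge> 1\<close>, is given by a closed path of length
  \<open>n\<close> without backtracking whose vertices are pairwise distinct; loops (\<open>n = 1\<close>) and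
  double edges (\<open>n = 2\<close>) are circuits.
\<close>

definition circuit :: "('v, 'e) sgraph \<Rightarrow> 'e list \<Rightarrow> bool" where
  "circuit G p \<longleftrightarrow>
     p \<noteq> [] \<and> edge_path G p \<and> trm G (last p) = org G (hd p) \<and>
     (\<forall>i. Suc i < length p \<longrightarrow> p ! Suc i \<noteq> opp G (p ! i)) \<and>
     distinct (map (trm G) p)"

definition serre_tree :: "('v, 'e) sgraph \<Rightarrow> bool" where
  "serre_tree G \<longleftrightarrow>
     serre_graph G \<and> verts G \<noteq> {} \<and> connected_graph G \<and> (\<nexists>p. circuit G p)"

record ('x, 'v, 'e) graph_field =
  vert_sp :: "('x, 'v) fibred"
  edge_sp :: "('x, 'e) fibred"
  forg :: "'e \<Rightarrow> 'v"
  ftrm :: "'e \<Rightarrow> 'v"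
  fopp :: "'e \<Rightarrow> 'e"

definition total_graph :: "('x, 'v, 'e) graph_field \<Rightarrow> ('v, 'e) sgraph" where
  "total_graph A =
     \<lparr>verts = space (fib_space (vert_sp A)), edges = space (fib_space (edge_sp A)),
      org = forg A, trm = ftrm A, opp = fopp A\<rparr>"

definition fibre_graph :: "('x, 'v, 'e) graph_field \<Rightarrow> 'x \<Rightarrow> ('v, 'e) sgraph" where
  "fibre_graph A x =
     \<lparr>verts = fibre (vert_sp A) x, edges = fibre (edge_sp A) x,
      org = forg A, trm = ftrm A, opp = fopp A\<rparr>"

definition borel_graph_field ::
    "'x measure \<Rightarrow> ('x \<times> 'x) set \<Rightarrow> ('x, 'v, 'e) graph_field \<Rightarrow> bool" where
  "borel_graph_field X R A \<longleftrightarrow>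
     serre_graph (total_graph A) \<and>
     R_fibred_standard_space X R (vert_sp A) \<and>
     R_fibred_standard_space X R (edge_sp A) \<and>
     fibred_morphism R (edge_sp A) (vert_sp A) (forg A) \<and>
     fibred_morphism R (edge_sp A) (vert_sp A) (ftrm A) \<and>
     fibred_morphism R (edge_sp A) (edge_sp A) (fopp A)"

definition arboretum :: "'x measure \<Rightarrow> ('x \<times> 'x) set \<Rightarrow> ('x, 'v, 'e) graph_field \<Rightarrow> bool" where
  "arboretum X R A \<longleftrightarrow>
     borel_graph_field X R A \<and> (\<forall>x\<in>space X. serre_tree (fibre_graph A x))"

definition orientation :: "('x \<times> 'x) set \<Rightarrow> ('x, 'v, 'e) graph_field \<Rightarrow> 'e set \<Rightarrow> bool" where
  "orientation R A E \<longleftrightarrow>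
     E \<in> sets (fib_space (edge_sp A)) \<and> R_invariant R (edge_sp A) E \<and>
     (\<forall>a\<in>space (fib_space (edge_sp A)). a \<in> E \<longleftrightarrow> fopp A a \<notin> E)"

definition borel_subrelation :: "'x measure \<Rightarrow> ('x \<times> 'x) set \<Rightarrow> ('x \<times> 'x) set \<Rightarrow> bool" where
  "borel_subrelation X Q' Q \<longleftrightarrow> borel_equiv_rel X Q' \<and> Q' \<subseteq> Q"

definition generated_by ::
    "'x measure \<Rightarrow> ('x \<times> 'x) set \<Rightarrow> ('x \<times> 'x) set \<Rightarrow> ('x \<times> 'x) set \<Rightarrow> bool" where
  "generated_by X Q Q1 Q2 \<longleftrightarrow> Q = \<Inter>{E. equiv (space X) E \<and> Q1 \<union> Q2 \<subseteq> E}"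

text \<open>Tuples are lists, so indices start at \<open>0\<close> instead of \<open>1\<close>.\<close>

definition reduced_tuple ::
    "('x \<times> 'x) set \<Rightarrow> ('x \<times> 'x) set \<Rightarrow> ('x \<times> 'x) set \<Rightarrow> 'x list \<Rightarrow> bool" where
  "reduced_tuple Q1 Q2 Q3 xs \<longleftrightarrow>
     length xs \<ge> 2 \<and>
     (\<exists>j :: nat \<Rightarrow> nat.
        (\<forall>i. Suc i < length xs \<longrightarrow>
           j i \<in> {1, 2} \<and> (xs ! i, xs ! Suc i) \<in> (if j i = 1 then Q1 else Q2)) \<and>
        (\<forall>i. Suc (Suc i) < length xs \<longrightarrow> j i \<noteq> j (Suc i))) \<and>
     (length xs > 2 \<longrightarrow> (\<forall>i. Suc i < length xs \<longrightarrow> (xs ! i, xs ! Suc i) \<notin> Q3)) \<and>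
     (length xs = 2 \<longrightarrow> xs ! 0 \<noteq> xs ! 1)"

definition amalgamated_product ::
    "'x measure \<Rightarrow> ('x \<times> 'x) set \<Rightarrow> ('x \<times> 'x) set \<Rightarrow> ('x \<times> 'x) set \<Rightarrow> ('x \<times> 'x) set \<Rightarrow> bool"
  where
  "amalgamated_product X Q Q1 Q2 Q3 \<longleftrightarrow>
     borel_equiv_rel X Q \<and>
     borel_subrelation X Q1 Q \<and> borel_subrelation X Q2 Q \<and>
     borel_subrelation X Q3 Q1 \<and> borel_subrelation X Q3 Q2 \<and>
     generated_by X Q Q1 Q2 \<and>
     (\<forall>xs. reduced_tuple Q1 Q2 Q3 xs \<longrightarrow> last xs \<noteq> hd xs)"

end

(* Fix x in X and let I be the set of points of B equivalent to x. Every positive edge of the graph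
   over x is (x,y).s(y) for some y in I, every vertex is (x,y).o(s(y)) or (x,y).t(s(y)) but not
   both, and two points of I give the same edge (origin, terminus) exactly when they are equivalent
   under the stabiliser of s (of o(s), of t(s)). So the fibre over x is the coset graph of
   Bass--Serre theory: it is connected iff the two vertex stabilisers generate the relation on I,
   and walks without backtracking correspond to reduced tuples. *)
theory Submission
  imports Defs
begin

text \<open>The correspondence between walks and tuples is delicate at the point where they close
  up. The walk of a closed reduced tuple need not be closed: its last edge only returns to one of
  the two ends of its first edge. So the argument extracts a repeated vertex and cuts a circuit out
  of the walk. Conversely, \<open>circuit\<close> forbids backtracking inside the list only, and the
  closing turn has to be controlled through the distinctness of the vertices.

  The bipartition of the vertices does double work. It excludes loops, and it makes a vertex common
  to two positive edges the origin of both or the terminus of both. Hence positive and negative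
  edges alternate along a walk, which is the alternation of \<open>Q1\<close> and \<open>Q2\<close>,
  while avoiding \<open>Q3\<close> is the absence of backtracking. A double edge, for instance, is a
  triple y, z, y with (y, z) in \<open>Q1\<close> and \<open>Q2\<close> but not in
  \<open>Q3\<close>.

  All this concerns one fibre. That the stabilisers are Borel is a separate matter: each is the set
  where two Borel maps into a standard Borel space agree.\<close>

section \<open>Paths and circuits\<close>

lemma edge_path_Cons:
  "edge_path G (a # p) \<longleftrightarrow>
     a \<in> edges G \<and> edge_path G p \<and> (p \<noteq> [] \<longrightarrow> trm G a = org G (hd p))"
proof -
  have "(\<forall>i. Suc i < length (a # p) \<longrightarrow> trm G ((a # p) ! i) = org G ((a # p) ! Suc i)) \<longleftrightarrow>
    (p \<noteq> [] \<longrightarrow> trm G a = org G (hd p)) \<and>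
    (\<forall>i. Suc i < length p \<longrightarrow> trm G (p ! i) = org G (p ! Suc i))" (is "?L \<longleftrightarrow> ?R")
  proof
    assume L: ?L
    show ?R
    proof (intro conjI impI allI)
      show "trm G a = org G (hd p)" if "p \<noteq> []"
        using L[rule_format, of 0] that by (simp add: hd_conv_nth)
      show "trm G (p ! i) = org G (p ! Suc i)" if "Suc i < length p" for i
        using L[rule_format, of "Suc i"] that by simp
    qed
  next
    assume R: ?R
    show ?L
    proof (intro allI impI)
      fix i assume "Suc i < length (a # p)"
      then show "trm G ((a # p) ! i) = org G ((a # p) ! Suc i)"
        using R by (cases i) (auto simp: hd_conv_nth)
    qed
  qed
  then show ?thesis unfolding edge_path_def by auto
qed

text \<open>Walks are lists, whereas generation is a closure of a relation. In closure form both
  sides can be compared by induction, and reflexivity absorbs the case \<open>u = v\<close> of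
  \<open>connected_graph\<close>.\<close>

definition adjacency :: "('v, 'e) sgraph \<Rightarrow> ('v \<times> 'v) set" where
  "adjacency G = {(org G a, trm G a) | a. a \<in> edges G}"

lemma edge_path_adjacency:
  "edge_path G p \<Longrightarrow> p \<noteq> [] \<Longrightarrow> (org G (hd p), trm G (last p)) \<in> (adjacency G)\<^sup>*"
proof (induction p)
  case Nil
  then show ?case by simp
next
  case (Cons a p)
  have a: "(org G a, trm G a) \<in> adjacency G"
    using Cons.prems by (auto simp: edge_path_Cons adjacency_def)
  show ?case
  proof (cases "p = []")
    case True
    then show ?thesis using a by auto
  next
    case False
    then have "(trm G a, trm G (last p)) \<in> (adjacency G)\<^sup>*"
      using Cons by (auto simp: edge_path_Cons)
    then show ?thesis using a False by (auto intro: converse_rtrancl_into_rtrancl)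
  qed
qed

lemma adjacency_edge_path:
  assumes "(u, v) \<in> (adjacency G)\<^sup>*"
  shows "u = v \<or> (\<exists>p. p \<noteq> [] \<and> edge_path G p \<and> org G (hd p) = u \<and> trm G (last p) = v)"
  using assms
proof (induction rule: converse_rtrancl_induct)
  case base
  then show ?case by simp
next
  case (step u w)
  from step.hyps(1) obtain a where a: "a \<in> edges G" "org G a = u" "trm G a = w"
    by (auto simp: adjacency_def)
  from step.IH show ?case
  proof
    assume "w = v"
    then show ?thesis using a
      by (intro disjI2 exI[of _ "[a]"]) (simp add: edge_path_def)
  next
    assume "\<exists>p. p \<noteq> [] \<and> edge_path G p \<and> org G (hd p) = w \<and> trm G (last p) = v"
    then obtain p where "p \<noteq> []" "edge_path G p" "org G (hd p) = w" "trm G (last p) = v"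
      by blast
    then show ?thesis using a
      by (intro disjI2 exI[of _ "a # p"]) (simp add: edge_path_Cons)
  qed
qed

lemma connected_graph_iff_adjacency:
  "connected_graph G \<longleftrightarrow> (\<forall>u\<in>verts G. \<forall>v\<in>verts G. (u, v) \<in> (adjacency G)\<^sup>*)"
  unfolding connected_graph_def
  by (metis adjacency_edge_path edge_path_adjacency rtrancl.rtrancl_refl)

lemma serre_graph_trm_opp:
  "serre_graph G \<Longrightarrow> a \<in> edges G \<Longrightarrow> trm G (opp G a) = org G a"
  unfolding serre_graph_def by metis

text \<open>If two termini agree, the repetition survives in the tail, whose origin is the terminus
  of the removed edge. Otherwise the walk returns to its start, and the prefix up to that return is
  the circuit.\<close>

lemma circuit_of_repeated_vertex:
  assumes "edge_path G p" "p \<noteq> []"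
    and "\<forall>i. Suc i < length p \<longrightarrow> p ! Suc i \<noteq> opp G (p ! i)"
    and "\<not> distinct (org G (hd p) # map (trm G) p)"
  shows "\<exists>c. circuit G c"
  using assms
proof (induction p)
  case Nil
  then show ?case by simp
next
  case (Cons a q)
  show ?case
  proof (cases "distinct (map (trm G) (a # q))")
    case True
    then have "org G a \<in> set (map (trm G) (a # q))"
      using Cons.prems(4) by auto
    then obtain b where "b \<in> set (a # q)" "trm G b = org G a"
      unfolding set_map by (metis imageE)
    then obtain k where k: "k < length (a # q)" "trm G ((a # q) ! k) = org G a"
      unfolding in_set_conv_nth by blast
    let ?c = "take (Suc k) (a # q)"
    have len: "length ?c = Suc k" using k(1) by simp
    have "last ?c = (a # q) ! k"
      using k(1) by (metis take_Suc_conv_app_nth last_snoc)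
    moreover have "hd ?c = a" by simp
    moreover have "set ?c \<subseteq> edges G"
      using Cons.prems(1) set_take_subset unfolding edge_path_def by (metis order_trans)
    moreover have "distinct (map (trm G) ?c)"
      using True by (metis distinct_take take_map)
    moreover have "\<forall>i. Suc i < length ?c \<longrightarrow>
        trm G (?c ! i) = org G (?c ! Suc i) \<and> ?c ! Suc i \<noteq> opp G (?c ! i)"
    proof (intro allI impI)
      fix i assume "Suc i < length ?c"
      then have "Suc i < Suc k" "Suc i < length (a # q)" using len k(1) by auto
      then show "trm G (?c ! i) = org G (?c ! Suc i) \<and> ?c ! Suc i \<noteq> opp G (?c ! i)"
        using Cons.prems(1,3) unfolding edge_path_def by (metis Suc_lessD nth_take)
    qed
    moreover have "?c \<noteq> []" by simp
    ultimately have "circuit G ?c"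
      using k(2) unfolding circuit_def edge_path_def by metis
    then show ?thesis by blast
  next
    case False
    then have q: "q \<noteq> []" by auto
    have "\<not> distinct (org G (hd q) # map (trm G) q)"
      using False Cons.prems(1) q by (simp add: edge_path_Cons)
    moreover have "\<forall>i. Suc i < length q \<longrightarrow> q ! Suc i \<noteq> opp G (q ! i)"
      using Cons.prems(3) by (metis Suc_less_eq length_Cons nth_Cons_Suc)
    ultimately show ?thesis
      using Cons.IH Cons.prems(1) q by (simp add: edge_path_Cons)
  qed
qed

section \<open>Coset graphs\<close>

text \<open>
  The edges \<open>\<epsilon> y\<close> for \<open>y \<in> I\<close> are the positively oriented ones; \<open>Q1\<close>, \<open>Q2\<close> and \<open>Q3\<close> are
  typically defined on a larger set, of which \<open>I\<close> is a union of classes.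
\<close>

locale coset_graph =
  fixes G :: "('v, 'e) sgraph" and I :: "'x set" and \<epsilon> :: "'x \<Rightarrow> 'e"
    and Q1 Q2 Q3 :: "('x \<times> 'x) set"
  assumes serre: "serre_graph G"
    and edge: "y \<in> I \<Longrightarrow> \<epsilon> y \<in> edges G"
    and edge_cover: "a \<in> edges G \<Longrightarrow> \<exists>y\<in>I. a = \<epsilon> y \<or> a = opp G (\<epsilon> y)"
    and vert_cover: "v \<in> verts G \<Longrightarrow> \<exists>y\<in>I. v = org G (\<epsilon> y) \<or> v = trm G (\<epsilon> y)"
    and bipartite: "y \<in> I \<Longrightarrow> z \<in> I \<Longrightarrow> org G (\<epsilon> y) \<noteq> trm G (\<epsilon> z)"
    and Q1_iff: "y \<in> I \<Longrightarrow> (y, z) \<in> Q1 \<longleftrightarrow> z \<in> I \<and> org G (\<epsilon> y) = org G (\<epsilon> z)"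
    and Q2_iff: "y \<in> I \<Longrightarrow> (y, z) \<in> Q2 \<longleftrightarrow> z \<in> I \<and> trm G (\<epsilon> y) = trm G (\<epsilon> z)"
    and Q3_iff: "y \<in> I \<Longrightarrow> (y, z) \<in> Q3 \<longleftrightarrow> z \<in> I \<and> \<epsilon> y = \<epsilon> z"
begin

section \<open>Connectedness of the graph against generation by \<open>Q1\<close> and
  \<open>Q2\<close>\<close>

abbreviation ends :: "'x \<Rightarrow> 'v set" where
  "ends y \<equiv> {org G (\<epsilon> y), trm G (\<epsilon> y)}"

lemma org_opp: "a \<in> edges G \<Longrightarrow> org G (opp G a) = trm G a"
  and opp_edge: "a \<in> edges G \<Longrightarrow> opp G a \<in> edges G"
  and opp_opp: "a \<in> edges G \<Longrightarrow> opp G (opp G a) = a"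
  and trm_opp: "a \<in> edges G \<Longrightarrow> trm G (opp G a) = org G a"
  using serre serre_graph_trm_opp[OF serre] by (auto simp: serre_graph_def)

lemma edge_vert: "y \<in> I \<Longrightarrow> v \<in> ends y \<Longrightarrow> v \<in> verts G"
  using serre edge by (auto simp: serre_graph_def)

text \<open>\<open>bipartite\<close> rules out that the origin of one edge is the terminus of the
  other. So \<open>Q1 \<union> Q2\<close> is incidence of positive edges, and generation becomes
  connectedness of the line graph.\<close>

lemma common_end_iff:
  "y \<in> I \<Longrightarrow> z \<in> I \<Longrightarrow> (\<exists>v. v \<in> ends y \<and> v \<in> ends z) \<longleftrightarrow> (y, z) \<in> Q1 \<union> Q2"
  using bipartite[of y z] bipartite[of z y] by (auto simp: Q1_iff Q2_iff)

lemma generated_closed: "(y, z) \<in> (Q1 \<union> Q2)\<^sup>* \<Longrightarrow> y \<in> I \<Longrightarrow> z \<in> I"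
  by (induction rule: rtrancl_induct) (auto simp: Q1_iff Q2_iff)

lemma adjacency_ends: "y \<in> I \<Longrightarrow> u \<in> ends y \<Longrightarrow> v \<in> ends y \<Longrightarrow> (u, v) \<in> (adjacency G)\<^sup>*"
proof -
  assume y: "y \<in> I" and uv: "u \<in> ends y" "v \<in> ends y"
  have "(org G (\<epsilon> y), trm G (\<epsilon> y)) \<in> adjacency G"
    using edge[OF y] by (auto simp: adjacency_def)
  moreover have "(trm G (\<epsilon> y), org G (\<epsilon> y)) \<in> adjacency G"
    unfolding adjacency_def
    using edge[OF y] by (intro CollectI exI[of _ "opp G (\<epsilon> y)"]) (simp add: org_opp trm_opp opp_edge)
  ultimately show ?thesis using uv by auto
qed

text \<open>A vertex lies on many edges, so \<open>z\<close> is generalised in the induction: the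
  hypothesis is applied to the edge just traversed, which contains both the old and the new
  vertex.\<close>

lemma adjacency_imp_generated:
  assumes "(u, v) \<in> (adjacency G)\<^sup>*" "y \<in> I" "u \<in> ends y" "z \<in> I" "v \<in> ends z"
  shows "(y, z) \<in> (Q1 \<union> Q2)\<^sup>*"
  using assms(1,4,5)
proof (induction arbitrary: z rule: rtrancl_induct)
  case base
  then show ?case using common_end_iff[OF \<open>y \<in> I\<close> base(1)] assms(3) by blast
next
  case (step v w)
  from step.hyps(2) obtain a where a: "a \<in> edges G" "v = org G a" "w = trm G a"
    by (auto simp: adjacency_def)
  then obtain e where e: "e \<in> I" "a = \<epsilon> e \<or> a = opp G (\<epsilon> e)"
    using edge_cover by blast
  then have ends: "v \<in> ends e" "w \<in> ends e"
    using a edge[OF e(1)] by (auto simp: org_opp trm_opp)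
  have "(y, e) \<in> (Q1 \<union> Q2)\<^sup>*" using step.IH e(1) ends(1) .
  moreover have "(e, z) \<in> Q1 \<union> Q2"
    using common_end_iff[OF e(1) step.prems(1)] ends(2) step.prems(2) by blast
  ultimately show ?case by (rule rtrancl_into_rtrancl)
qed

lemma generated_imp_adjacency:
  assumes "(y, z) \<in> (Q1 \<union> Q2)\<^sup>*" "y \<in> I" "u \<in> ends y" "v \<in> ends z"
  shows "(u, v) \<in> (adjacency G)\<^sup>*"
  using assms(1,4)
proof (induction arbitrary: v rule: rtrancl_induct)
  case base
  then show ?case using adjacency_ends assms(2,3) by blast
next
  case (step z w)
  have z: "z \<in> I" using generated_closed step.hyps(1) assms(2) .
  have w: "w \<in> I" using step.hyps(2) z by (auto simp: Q1_iff Q2_iff)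
  obtain c where c: "c \<in> ends z" "c \<in> ends w"
    using common_end_iff[OF z w] step.hyps(2) by blast
  have "(u, c) \<in> (adjacency G)\<^sup>*" using step.IH c(1) .
  also have "(c, v) \<in> (adjacency G)\<^sup>*" using adjacency_ends w c(2) step.prems .
  finally show ?case .
qed

text \<open>By \<open>vert_cover\<close> there are no isolated vertices, so every vertex can be
  traded for a positive edge that contains it.\<close>

lemma connected_iff_generated:
  "connected_graph G \<longleftrightarrow> (\<forall>y\<in>I. \<forall>z\<in>I. (y, z) \<in> (Q1 \<union> Q2)\<^sup>*)" (is "_ \<longleftrightarrow> ?R")
proof
  assume c: "connected_graph G"
  show ?R
  proof (intro ballI)
    fix y z assume y: "y \<in> I" and z: "z \<in> I"
    have "(org G (\<epsilon> y), org G (\<epsilon> z)) \<in> (adjacency G)\<^sup>*"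
      using c edge_vert y z by (auto simp: connected_graph_iff_adjacency)
    then show "(y, z) \<in> (Q1 \<union> Q2)\<^sup>*" by (rule adjacency_imp_generated) (use y z in auto)
  qed
next
  assume R: ?R
  show "connected_graph G"
    unfolding connected_graph_iff_adjacency
  proof (intro ballI)
    fix u v assume "u \<in> verts G" "v \<in> verts G"
    then obtain y z where "y \<in> I" "u \<in> ends y" "z \<in> I" "v \<in> ends z"
      using vert_cover by blast
    then show "(u, v) \<in> (adjacency G)\<^sup>*" using generated_imp_adjacency R by blast
  qed
qed

section \<open>Circuits against closed reduced tuples\<close>

text \<open>Every entry but the last contributes an edge. The last entry, equal to the first, only
  says that the final vertex lies on the first edge; this already forces a repeated vertex.\<close>

lemma circuit_of_reduced_tuple:
  assumes red: "reduced_tuple Q1 Q2 Q3 xs" and closed: "last xs = hd xs" and hd: "hd xs \<in> I"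
  shows "\<exists>c. circuit G c"
proof -
  obtain j :: "nat \<Rightarrow> nat" where
    step: "\<And>i. Suc i < length xs \<Longrightarrow>
      j i \<in> {1, 2} \<and> (xs ! i, xs ! Suc i) \<in> (if j i = 1 then Q1 else Q2)"
    and alt: "\<And>i. Suc (Suc i) < length xs \<Longrightarrow> j i \<noteq> j (Suc i)"
    using red unfolding reduced_tuple_def by blast
  have ne: "xs \<noteq> []" using red by (auto simp: reduced_tuple_def)
  have hd0: "hd xs = xs ! 0" using ne by (simp add: hd_conv_nth)
  have last0: "xs ! (length xs - 1) = xs ! 0" using closed ne hd0 by (simp add: last_conv_nth)
  \<comment> \<open>A reduced pair has distinct entries and cannot close up; from length 3 on,
    avoidance of \<open>Q3\<close> is available.\<close>
  have "length xs \<noteq> 2"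
  proof
    assume "length xs = 2"
    then show False using red last0 by (simp add: reduced_tuple_def)
  qed
  then have len: "length xs > 2" using red by (simp add: reduced_tuple_def)
  then have notQ3: "\<And>i. Suc i < length xs \<Longrightarrow> (xs ! i, xs ! Suc i) \<notin> Q3"
    using red by (simp add: reduced_tuple_def)
  have I: "xs ! i \<in> I" if "i < length xs" for i
    using that
  proof (induction i)
    case 0
    then show ?case using hd hd0 by simp
  next
    case (Suc i)
    then show ?case using step[of i] by (auto simp: Q1_iff Q2_iff split: if_splits)
  qed
  \<comment> \<open>Each edge is traversed towards the endpoint it shares with the next one.\<close>
  define d where "d i = (if j i = 1 then opp G (\<epsilon> (xs ! i)) else \<epsilon> (xs ! i))" for i
  define p where "p = map d [0..<length xs - 1]"
  have d_edge: "d i \<in> edges G" if "i < length xs" for i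
    using edge[OF I[OF that]] by (simp add: d_def opp_edge)
  have path: "trm G (d i) = org G (d (Suc i)) \<and> d (Suc i) \<noteq> opp G (d i)"
    if i: "Suc (Suc i) < length xs" for i
  proof -
    have y: "xs ! i \<in> I" "xs ! Suc i \<in> I" using I i by auto
    have e: "\<epsilon> (xs ! i) \<in> edges G" "\<epsilon> (xs ! Suc i) \<in> edges G" using edge y by auto
    have neq: "\<epsilon> (xs ! i) \<noteq> \<epsilon> (xs ! Suc i)" using notQ3[of i] i y by (simp add: Q3_iff)
    from step[of i] step[of "Suc i"] alt[of i] i
    consider "j i = 1" "j (Suc i) = 2" "(xs ! i, xs ! Suc i) \<in> Q1"
      | "j i = 2" "j (Suc i) = 1" "(xs ! i, xs ! Suc i) \<in> Q2"
      by fastforce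
    then show ?thesis
    proof cases
      case 1
      then show ?thesis using y e neq
        by (simp add: d_def Q1_iff trm_opp opp_opp)
    next
      case 2
      then have "opp G (\<epsilon> (xs ! Suc i)) \<noteq> opp G (\<epsilon> (xs ! i))"
        using neq opp_opp e by metis
      then show ?thesis using 2 y e
        by (simp add: d_def Q2_iff org_opp)
    qed
  qed
  \<comment> \<open>The index of the last edge of the walk; the entry after it is the last one,
    which equals \<open>xs ! 0\<close>.\<close>
  let ?n = "length xs - 2"
  have last_step: "j ?n \<in> {1, 2} \<and> (xs ! ?n, xs ! 0) \<in> (if j ?n = 1 then Q1 else Q2)"
  proof -
    have "Suc ?n = length xs - 1" using len by simp
    then show ?thesis using step[of ?n] last0 len by simp
  qed
  have y: "xs ! ?n \<in> I" "xs ! 0 \<in> I" using len by (auto intro!: I)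
  have e: "\<epsilon> (xs ! ?n) \<in> edges G" "\<epsilon> (xs ! 0) \<in> edges G" using edge y by auto
  have j0: "j 0 \<in> {1, 2}" using step[of 0] len by simp
  \<comment> \<open>The final vertex is an end of \<open>\<epsilon> (xs ! 0)\<close>; which end of
    \<open>d 0\<close> this is depends on \<open>j 0\<close> and \<open>j ?n\<close>.\<close>
  have rep: "trm G (d ?n) = org G (d 0) \<or> trm G (d ?n) = trm G (d 0)"
    using last_step j0 y e by (auto simp: d_def Q1_iff Q2_iff org_opp trm_opp split: if_splits)
  have "edge_path G p"
    unfolding edge_path_def
  proof (intro conjI allI impI)
    show "set p \<subseteq> edges G" using d_edge by (auto simp: p_def)
    show "trm G (p ! i) = org G (p ! Suc i)" if "Suc i < length p" for i
      using path[of i] that by (simp add: p_def)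
  qed
  moreover have "p \<noteq> []" using len by (auto simp: p_def)
  moreover have "\<forall>i. Suc i < length p \<longrightarrow> p ! Suc i \<noteq> opp G (p ! i)"
    using path by (simp add: p_def)
  moreover have "\<not> distinct (org G (hd p) # map (trm G) p)"
  proof
    assume dist: "distinct (org G (hd p) # map (trm G) p)"
    \<comment> \<open>The prepended origin shifts indices by one, so the walk ends at position
      \<open>Suc ?n\<close>. This differs from 0 and from 1 because the tuple has more than two
      entries.\<close>
    let ?vs = "org G (hd p) # map (trm G) p"
    have "hd p = d 0" using len by (simp add: p_def hd_conv_nth)
    then have v: "?vs ! 0 = org G (d 0)" "?vs ! 1 = trm G (d 0)" "?vs ! Suc ?n = trm G (d ?n)"
      using len by (simp_all add: p_def)
    have l: "0 < length ?vs" "1 < length ?vs" "Suc ?n < length ?vs"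
      using len by (simp_all add: p_def)
    have "?vs ! Suc ?n \<noteq> ?vs ! 0" using dist l(1,3) by (metis nth_eq_iff_index_eq nat.distinct(1))
    moreover have "?vs ! Suc ?n \<noteq> ?vs ! 1"
      using nth_eq_iff_index_eq[OF dist l(3,2)] len by simp
    ultimately show False using rep v by simp
  qed
  ultimately show ?thesis by (rule circuit_of_repeated_vertex)
qed

text \<open>The circuit is read cyclically and each edge is replaced by a label in \<open>I\<close>;
  one full turn gives the tuple, with the first label repeated at the end.\<close>

lemma reduced_tuple_of_circuit:
  assumes c: "circuit G p"
  shows "\<exists>xs. reduced_tuple Q1 Q2 Q3 xs \<and> last xs = hd xs \<and> hd xs \<in> I"
proof -
  let ?m = "length p"
  have m: "?m > 0" using c by (simp add: circuit_def)
  have p_edge: "p ! i \<in> edges G" if "i < ?m" for i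
    using c that by (auto simp: circuit_def edge_path_def)
  define q where "q i = p ! (i mod ?m)" for i
  have q_edge: "q i \<in> edges G" for i using p_edge m by (simp add: q_def)
  \<comment> \<open>An edge has many labels, namely a whole class of \<open>Q3\<close>. Choosing the
    label as a function of the edge, not of the position, makes the tuple close up exactly.\<close>
  have "\<forall>a\<in>edges G. \<exists>y. y \<in> I \<and> (a = \<epsilon> y \<or> a = opp G (\<epsilon> y))" using edge_cover by blast
  then obtain h where h: "\<And>a. a \<in> edges G \<Longrightarrow> h a \<in> I \<and> (a = \<epsilon> (h a) \<or> a = opp G (\<epsilon> (h a)))"
    by metis
  define y where "y i = h (q i)" for i
  have yI: "y i \<in> I" and q_cases: "q i = \<epsilon> (y i) \<or> q i = opp G (\<epsilon> (y i))" for i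
    using h[OF q_edge] by (auto simp: y_def)
  have ye: "\<epsilon> (y i) \<in> edges G" for i using edge yI .
  have no_loop: "org G (q i) \<noteq> trm G (q i)" for i
    using q_cases[of i] bipartite[OF yI[of i] yI[of i]] ye[of i] by (auto simp: org_opp trm_opp)
  have q_path: "trm G (q i) = org G (q (Suc i))" for i
  proof (cases "Suc (i mod ?m) = ?m")
    case True
    then have "q (Suc i) = hd p" "q i = last p"
      using m by (auto simp: q_def mod_Suc hd_conv_nth last_conv_nth
          intro!: arg_cong[of _ _ "(!) p"])
    then show ?thesis using c by (simp add: circuit_def)
  next
    case False
    moreover have "Suc (i mod ?m) < ?m" using False m by (metis Suc_lessI mod_less_divisor)
    ultimately show ?thesis using c by (simp add: q_def mod_Suc circuit_def edge_path_def)
  qed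
  \<comment> \<open>A circuit with one edge would be a loop. So the tuple has at least three entries
    and the clause on pairs is void.\<close>
  have m2: "?m \<ge> 2"
  proof (rule ccontr)
    assume "\<not> ?m \<ge> 2"
    then have "?m = 1" using m by linarith
    then have "q (Suc 0) = q 0" by (simp add: q_def)
    then show False using q_path[of 0] no_loop[of 0] by simp
  qed
  \<comment> \<open>At the closing turn, backtracking would make the termini of the first and of the
    last but one edge agree. Distinctness then leaves only length 2, where the opposite of the
    closing turn is the inner turn excluded by \<open>circuit\<close>.\<close>
  have q_nb: "q (Suc i) \<noteq> opp G (q i)" for i
  proof (cases "Suc (i mod ?m) = ?m")
    case True
    then have q: "q (Suc i) = p ! 0" "q i = p ! (?m - 1)"
      using m by (auto simp: q_def mod_Suc intro!: arg_cong[of _ _ "(!) p"])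
    show ?thesis
    proof
      assume eq: "q (Suc i) = opp G (q i)"
      have "trm G (p ! 0) = org G (p ! (?m - 1))"
        using eq q q_edge[of i] by (metis trm_opp)
      also have "\<dots> = trm G (p ! (?m - 2))"
        using q_path[of "?m - 2"] m2 by (simp add: q_def Suc_diff_Suc numeral_2_eq_2)
      finally have "trm G (p ! 0) = trm G (p ! (?m - 2))" .
      moreover have "0 < ?m" "?m - 2 < ?m" using m2 by linarith+
      ultimately have "map (trm G) p ! 0 = map (trm G) p ! (?m - 2)" by (simp only: nth_map)
      moreover have "distinct (map (trm G) p)" using c by (simp add: circuit_def)
      ultimately have "0 = ?m - 2" using m2
        by (subst (asm) nth_eq_iff_index_eq) auto
      then have "?m = 2" using m2 by simp
      then have "p ! 1 \<noteq> opp G (p ! 0)" "q (Suc i) = p ! 0" "q i = p ! 1"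
        using c q by (auto simp: circuit_def)
      then show False using eq q_edge[of i] by (metis opp_opp)
    qed
  next
    case False
    moreover have "Suc (i mod ?m) < ?m" using False m by (metis Suc_lessI mod_less_divisor)
    ultimately show ?thesis using c by (simp add: q_def mod_Suc circuit_def)
  qed
  \<comment> \<open>A positively traversed edge meets its successor at its own terminus, which gives
    \<open>Q2\<close>; a negatively traversed one meets it at the origin of the positive edge, which
    gives \<open>Q1\<close>.\<close>
  define j :: "nat \<Rightarrow> nat" where "j i = (if q i = \<epsilon> (y i) then 2 else 1)" for i
  have step: "(y i, y (Suc i)) \<in> (if j i = 1 then Q1 else Q2) \<and> j i \<noteq> j (Suc i)" for i
  proof (cases "q i = \<epsilon> (y i)")
    case True
    then have "trm G (\<epsilon> (y i)) = org G (q (Suc i))" using q_path[of i] by simp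
    then have q': "q (Suc i) \<noteq> \<epsilon> (y (Suc i))" "q (Suc i) = opp G (\<epsilon> (y (Suc i)))"
      using bipartite[OF yI[of "Suc i"] yI[of i]] q_cases[of "Suc i"] by auto
    then have "trm G (\<epsilon> (y i)) = trm G (\<epsilon> (y (Suc i)))"
      using q_path[of i] True ye by (simp add: org_opp)
    then show ?thesis using True q' yI by (simp add: j_def Q2_iff)
  next
    case False
    then have q: "q i = opp G (\<epsilon> (y i))" using q_cases[of i] by simp
    then have o: "org G (\<epsilon> (y i)) = org G (q (Suc i))" using q_path[of i] ye by (simp add: trm_opp)
    then have "q (Suc i) \<noteq> opp G (\<epsilon> (y (Suc i)))"
      using bipartite[OF yI[of i] yI[of "Suc i"]] ye by (auto simp: org_opp)
    then have "q (Suc i) = \<epsilon> (y (Suc i))" using q_cases[of "Suc i"] by simp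
    then show ?thesis using False o yI by (simp add: j_def Q1_iff)
  qed
  \<comment> \<open>Equal underlying edges mean that the next edge either reverses the current one
    or repeats it; repetition would make it a loop.\<close>
  have notQ3: "(y i, y (Suc i)) \<notin> Q3" for i
  proof
    assume "(y i, y (Suc i)) \<in> Q3"
    then have "\<epsilon> (y i) = \<epsilon> (y (Suc i))" using yI by (simp add: Q3_iff)
    then have "q (Suc i) = q i \<or> q (Suc i) = opp G (q i)"
      using q_cases[of i] q_cases[of "Suc i"] ye[of i] by (auto simp: opp_opp)
    then show False using q_nb[of i] q_path[of i] no_loop[of i] by auto
  qed
  define xs where "xs = map y [0..<Suc ?m]"
  have "reduced_tuple Q1 Q2 Q3 xs"
    unfolding reduced_tuple_def
  proof (intro conjI exI[of _ j] allI impI)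
    show "2 \<le> length xs" using m2 by (simp add: xs_def)
    show "j i \<in> {1, 2}" for i by (simp add: j_def)
    show "(xs ! i, xs ! Suc i) \<in> (if j i = 1 then Q1 else Q2)" if "Suc i < length xs" for i
      using step[of i] that by (simp add: xs_def del: upt_Suc)
    show "j i \<noteq> j (Suc i)" for i using step by blast
    show "(xs ! i, xs ! Suc i) \<notin> Q3" if "Suc i < length xs" for i
      using notQ3[of i] that by (simp add: xs_def del: upt_Suc)
    show "xs ! 0 \<noteq> xs ! 1" if "length xs = 2" using that m2 by (simp add: xs_def)
  qed
  moreover have "hd xs = y 0" "last xs = y ?m"
    by (simp_all add: xs_def hd_conv_nth del: upt_Suc) (simp add: last_conv_nth)
  moreover have "y ?m = y 0" by (simp add: y_def q_def)
  ultimately show ?thesis using yI by metis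
qed

text \<open>Neither \<open>Q1\<close> nor \<open>Q2\<close> leaves \<open>I\<close>, so the
  condition on \<open>hd xs\<close> confines the whole tuple to the labels of this graph.\<close>

lemma serre_tree_iff:
  "serre_tree G \<longleftrightarrow> verts G \<noteq> {} \<and> (\<forall>y\<in>I. \<forall>z\<in>I. (y, z) \<in> (Q1 \<union> Q2)\<^sup>*) \<and>
     (\<forall>xs. reduced_tuple Q1 Q2 Q3 xs \<longrightarrow> hd xs \<in> I \<longrightarrow> last xs \<noteq> hd xs)"
  unfolding serre_tree_def connected_iff_generated
  using serre circuit_of_reduced_tuple reduced_tuple_of_circuit by metis

end

section \<open>Stabilisers of partial sections\<close>

text \<open>In a Hausdorff space with a countable base, two values differ iff some basic open set
  contains the first and not the second. The set of disagreement is thus a countable union of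
  measurable sets.\<close>

lemma measurable_equalizer:
  assumes N: "standard_borel N" and f: "f \<in> M \<rightarrow>\<^sub>M N" and g: "g \<in> M \<rightarrow>\<^sub>M N"
  shows "{x \<in> space M. f x = g x} \<in> sets M"
proof -
  obtain T where T: "completely_metrizable_space T" "second_countable T"
      "space N = topspace T" "sets N = sigma_sets (topspace T) {U. openin T U}"
    using N unfolding standard_borel_def by blast
  obtain \<B> where \<B>: "countable \<B>" "\<And>V. V \<in> \<B> \<Longrightarrow> openin T V"
      "\<And>U x. openin T U \<Longrightarrow> x \<in> U \<Longrightarrow> \<exists>V\<in>\<B>. x \<in> V \<and> V \<subseteq> U"
    using T(2) unfolding second_countable_def by metis
  have Hausdorff: "Hausdorff_space T"
    using T(1) completely_metrizable_imp_metrizable_space metrizable_imp_Hausdorff_space by blast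
  have sep: "\<exists>V\<in>\<B>. f x \<in> V \<and> g x \<notin> V" if x: "x \<in> space M" and neq: "f x \<noteq> g x" for x
  proof -
    have "f x \<in> topspace T" "g x \<in> topspace T"
      using x f g T(3) by (auto dest: measurable_space)
    then obtain U V where "openin T U" "f x \<in> U" "openin T V" "g x \<in> V" "disjnt U V"
      using Hausdorff neq unfolding Hausdorff_space_def by metis
    then show ?thesis using \<B>(3) by (metis disjnt_iff subsetD)
  qed
  have "{x \<in> space M. f x = g x} =
      space M - (\<Union>V\<in>\<B>. (f -` V \<inter> space M) - (g -` V \<inter> space M))"
    using sep by force
  also have "\<dots> \<in> sets M"
  proof (intro sets.Diff sets.top sets.countable_UN'' \<B>(1))
    fix V assume "V \<in> \<B>"
    then have "V \<in> sets N" using \<B>(2) T(4) by auto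
    then show "f -` V \<inter> space M \<in> sets M" "g -` V \<inter> space M \<in> sets M"
      using f g by (auto intro: measurable_sets)
  qed
  finally show ?thesis .
qed

lemma sections_in_fibre:
  assumes "u \<in> restrict_space X B \<rightarrow>\<^sub>M fib_space F" "B \<subseteq> space X"
    and "\<forall>x\<in>B. fib_proj F (u x) = x" "x \<in> B"
  shows "u x \<in> fibre F x"
  using measurable_space[OF assms(1), of x] assms by (auto simp: fibre_def space_restrict_space)

context
  fixes X :: "'x measure" and R :: "('x \<times> 'x) set" and F :: "('x, 'f) fibred"
    and B :: "'x set" and u :: "'x \<Rightarrow> 'f"
  assumes R: "borel_equiv_rel X R" and F: "R_fibred_standard_space X R F"
    and u: "partial_section X F B u"
begin

lemma base_subset: "B \<subseteq> space X"
  using u sets.sets_into_space by (auto simp: partial_section_def)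

lemma section_in_fibre: "x \<in> B \<Longrightarrow> u x \<in> fibre F x"
  using u base_subset sections_in_fibre unfolding partial_section_def by metis

lemma rel_sym: "(x, y) \<in> R \<Longrightarrow> (y, x) \<in> R"
  and rel_trans: "(x, y) \<in> R \<Longrightarrow> (y, z) \<in> R \<Longrightarrow> (x, z) \<in> R"
  and rel_refl: "x \<in> space X \<Longrightarrow> (x, x) \<in> R"
  using R unfolding borel_equiv_rel_def
  by (auto elim: equivE dest: symD transD refl_onD)

lemma act_fibre: "(x, y) \<in> R \<Longrightarrow> f \<in> fibre F y \<Longrightarrow> fib_act F (x, y) f \<in> fibre F x"
  and act_id: "y \<in> space X \<Longrightarrow> f \<in> fibre F y \<Longrightarrow> fib_act F (y, y) f = f"
  and act_act: "(x, y) \<in> R \<Longrightarrow> (y, z) \<in> R \<Longrightarrow> f \<in> fibre F z \<Longrightarrow>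
    fib_act F (x, y) (fib_act F (y, z) f) = fib_act F (x, z) f"
  using F unfolding R_fibred_standard_space_def R_action_def by blast+

text \<open>Translating both values of the section into the fibre over a common base point
  \<open>x\<close> turns stabiliser membership into equality of two points of that fibre, the form
  required by \<open>coset_graph\<close>.\<close>

lemma Stab_iff:
  assumes "(x, y) \<in> R" "y \<in> B"
  shows "(y, z) \<in> Stab R F B u \<longleftrightarrow>
    z \<in> B \<and> (x, z) \<in> R \<and> fib_act F (x, y) (u y) = fib_act F (x, z) (u z)"
proof (cases "z \<in> B \<and> (x, z) \<in> R")
  case True
  then have R': "(y, z) \<in> R" "(z, y) \<in> R" "(z, x) \<in> R"
    using assms rel_sym rel_trans by blast+
  have "fib_act F (x, y) (u y) = fib_act F (x, z) (fib_act F (z, y) (u y))"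
    using act_act True R' assms section_in_fibre by simp
  moreover have "u z = fib_act F (z, x) (fib_act F (x, z) (u z))"
    using act_act act_id True R' section_in_fibre base_subset by auto
  moreover have "fib_act F (z, y) (u y) = fib_act F (z, x) (fib_act F (x, y) (u y))"
    using act_act R' assms section_in_fibre by simp
  ultimately show ?thesis
    using True R' assms unfolding Stab_def by auto
next
  case False
  then show ?thesis using assms rel_trans unfolding Stab_def by blast
qed

text \<open>With \<open>y\<close> itself as base point, \<open>Stab_iff\<close> describes the class
  of \<open>y\<close> by equality of translates, from which the three laws follow.\<close>

lemma equiv_Stab: "equiv B (Stab R F B u)"
proof (rule equivI)
  show "Stab R F B u \<subseteq> B \<times> B" by (auto simp: Stab_def)
  have self: "(y, y) \<in> R" if "y \<in> B" for y using rel_refl base_subset that by blast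
  show "refl_on B (Stab R F B u)"
    using Stab_iff self by (auto intro!: refl_onI)
  show "sym (Stab R F B u)"
  proof (rule symI)
    fix y z assume yz: "(y, z) \<in> Stab R F B u"
    then have "y \<in> B" "z \<in> B" "(y, z) \<in> R" by (auto simp: Stab_def)
    then show "(z, y) \<in> Stab R F B u"
      using yz Stab_iff[of y y z] Stab_iff[of y z y] self by auto
  qed
  show "trans (Stab R F B u)"
  proof (rule transI)
    fix y z w assume yz: "(y, z) \<in> Stab R F B u" and zw: "(z, w) \<in> Stab R F B u"
    then have "y \<in> B" "z \<in> B" "(y, z) \<in> R" by (auto simp: Stab_def)
    then show "(y, w) \<in> Stab R F B u"
      using yz zw Stab_iff[of y y z] Stab_iff[of y z w] Stab_iff[of y y w] self by auto
  qed
qed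

lemma restrict_rel_measurable:
  "restrict_rel R B \<in> sets (restrict_space X B \<Otimes>\<^sub>M restrict_space X B)"
proof -
  let ?P = "restrict_space X B \<Otimes>\<^sub>M restrict_space X B"
  have "(\<lambda>x. x) \<in> restrict_space X B \<rightarrow>\<^sub>M X" by (rule measurable_restrict_space1) simp
  then have "(\<lambda>p. (fst p, snd p)) \<in> ?P \<rightarrow>\<^sub>M X \<Otimes>\<^sub>M X"
    by (intro measurable_Pair)
      (auto intro: measurable_compose[OF measurable_fst] measurable_compose[OF measurable_snd])
  then have "(\<lambda>p. (fst p, snd p)) -` R \<inter> space ?P \<in> sets ?P"
    using R by (auto simp: borel_equiv_rel_def intro: measurable_sets)
  moreover have "(\<lambda>p. (fst p, snd p)) -` R \<inter> space ?P = restrict_rel R B"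
    using base_subset[THEN subsetD]
    by (auto simp: restrict_rel_def space_pair_measure space_restrict_space)
  ultimately show ?thesis by simp
qed

lemma borel_equiv_rel_Stab: "borel_equiv_rel (restrict_space X B) (Stab R F B u)"
proof -
  let ?M = "restrict_space X B"
  \<comment> \<open>The action is Borel only on \<open>act_domain\<close>, so the equalizer is
    formed inside the relation and then carried to the product, where the relation is
    measurable.\<close>
  let ?P = "restrict_space (?M \<Otimes>\<^sub>M ?M) (restrict_rel R B)"
  let ?act = "\<lambda>p. fib_act F (snd p, fst p) (u (fst p))"
  have space: "space ?M = B" using base_subset by (auto simp: space_restrict_space)
  have spaceP: "space ?P = restrict_rel R B"
    using base_subset[THEN subsetD]
    by (auto simp: space_restrict_space space_pair_measure restrict_rel_def)
  have fst: "fst \<in> ?P \<rightarrow>\<^sub>M ?M" and snd: "snd \<in> ?P \<rightarrow>\<^sub>M ?M"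
    by (rule measurable_restrict_space1, simp)+
  have id: "(\<lambda>x. x) \<in> ?M \<rightarrow>\<^sub>M X" by (rule measurable_restrict_space1) simp
  have um: "u \<in> ?M \<rightarrow>\<^sub>M fib_space F" using u by (simp add: partial_section_def)
  have "(\<lambda>p. ((snd p, fst p), u (fst p))) \<in> ?P \<rightarrow>\<^sub>M
      restrict_space ((X \<Otimes>\<^sub>M X) \<Otimes>\<^sub>M fib_space F) (act_domain R F)"
  proof (rule measurable_restrict_space2)
    show "(\<lambda>p. ((snd p, fst p), u (fst p))) \<in> space ?P \<rightarrow> act_domain R F"
      using rel_sym section_in_fibre
      unfolding spaceP by (auto simp: act_domain_def restrict_rel_def)
    show "(\<lambda>p. ((snd p, fst p), u (fst p))) \<in> ?P \<rightarrow>\<^sub>M (X \<Otimes>\<^sub>M X) \<Otimes>\<^sub>M fib_space F"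
      by (intro measurable_Pair measurable_compose[OF fst id] measurable_compose[OF snd id]
          measurable_compose[OF fst um])
  qed
  moreover have "(\<lambda>(p, f). fib_act F p f) \<in>
      restrict_space ((X \<Otimes>\<^sub>M X) \<Otimes>\<^sub>M fib_space F) (act_domain R F) \<rightarrow>\<^sub>M fib_space F"
    using F by (simp add: R_fibred_standard_space_def R_action_def)
  ultimately have "(\<lambda>p. (\<lambda>(p, f). fib_act F p f) ((snd p, fst p), u (fst p))) \<in>
      ?P \<rightarrow>\<^sub>M fib_space F"
    by (rule measurable_compose)
  then have "?act \<in> ?P \<rightarrow>\<^sub>M fib_space F" by simp
  moreover have "(\<lambda>p. u (snd p)) \<in> ?P \<rightarrow>\<^sub>M fib_space F"
    by (rule measurable_compose[OF snd um])
  moreover have "standard_borel (fib_space F)"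
    using F by (simp add: R_fibred_standard_space_def fibred_standard_space_def)
  ultimately have "{p \<in> space ?P. ?act p = u (snd p)} \<in> sets ?P"
    by (intro measurable_equalizer)
  moreover have "{p \<in> space ?P. ?act p = u (snd p)} = Stab R F B u"
    unfolding spaceP by (auto simp: Stab_def restrict_rel_def)
  ultimately have "Stab R F B u \<in> sets ?P" by simp
  then have "Stab R F B u \<in> sets (?M \<Otimes>\<^sub>M ?M)"
    using restrict_rel_measurable by (subst (asm) sets_restrict_space_iff) auto
  then show ?thesis using equiv_Stab by (simp add: borel_equiv_rel_def space)
qed

text \<open>The witness \<open>u y\<close> lies over \<open>y\<close>, so its projection can be
  replaced by \<open>y\<close>. This form provides the covering assumptions of
  \<open>coset_graph\<close>.\<close>

lemma mem_saturation_section_iff: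
  "v \<in> saturation R F (u ` B) \<longleftrightarrow>
     v \<in> space (fib_space F) \<and>
     (\<exists>y\<in>B. (fib_proj F v, y) \<in> R \<and> v = fib_act F (fib_proj F v, y) (u y))"
  using section_in_fibre unfolding saturation_def fib_rel_def fibre_def by fastforce

end

section \<open>The restricted relation and its generation by sub-relations\<close>

lemma borel_equiv_rel_restrict:
  assumes R: "borel_equiv_rel X R" and F: "R_fibred_standard_space X R F"
    and u: "partial_section X F B u"
  shows "borel_equiv_rel (restrict_space X B) (restrict_rel R B)"
proof -
  have B: "B \<subseteq> space X" using u sets.sets_into_space by (auto simp: partial_section_def)
  have "equiv (space X) R" using R by (simp add: borel_equiv_rel_def)
  then have "equiv B (restrict_rel R B)"
    unfolding equiv_def refl_on_def sym_def trans_def restrict_rel_def using B by blast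
  moreover have "space (restrict_space X B) = B" using B by (auto simp: space_restrict_space)
  ultimately show ?thesis
    using restrict_rel_measurable[OF assms] by (simp add: borel_equiv_rel_def)
qed

lemma generated_by_iff:
  assumes Q: "equiv (space X) Q" and Q1: "equiv (space X) Q1" and Q2: "equiv (space X) Q2"
    and sub: "Q1 \<union> Q2 \<subseteq> Q"
  shows "generated_by X Q Q1 Q2 \<longleftrightarrow> Q \<subseteq> (Q1 \<union> Q2)\<^sup>*"
proof
  have "Q1 \<union> Q2 \<subseteq> space X \<times> space X"
    using Q1 Q2 by (auto elim: equivE)
  \<comment> \<open>The transitive closure is used here because \<open>rtrancl\<close> contains the
    diagonal of the whole type and so need not be an equivalence on \<open>space X\<close>.\<close>
  then have "(Q1 \<union> Q2)\<^sup>+ \<subseteq> space X \<times> space X" by (rule trancl_subset_Sigma)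
  moreover have "refl_on (space X) ((Q1 \<union> Q2)\<^sup>+)"
    using Q1 by (auto elim!: equivE intro!: refl_onI dest: refl_onD)
  moreover have "sym ((Q1 \<union> Q2)\<^sup>+)"
    using Q1 Q2 by (auto elim!: equivE intro!: sym_trancl sym_Un)
  ultimately have "equiv (space X) ((Q1 \<union> Q2)\<^sup>+)" by (auto intro: equivI)
  moreover have "Q1 \<union> Q2 \<subseteq> (Q1 \<union> Q2)\<^sup>+" by auto
  moreover assume "generated_by X Q Q1 Q2"
  ultimately have "Q \<subseteq> (Q1 \<union> Q2)\<^sup>+" unfolding generated_by_def by blast
  then show "Q \<subseteq> (Q1 \<union> Q2)\<^sup>*" using trancl_into_rtrancl by auto
next
  assume gen: "Q \<subseteq> (Q1 \<union> Q2)\<^sup>*"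
  have "Q \<subseteq> E" if E: "equiv (space X) E" "Q1 \<union> Q2 \<subseteq> E" for E
  proof
    fix p assume p: "p \<in> Q"
    obtain y z where yz: "p = (y, z)" by force
    have "(y, z) \<in> (Q1 \<union> Q2)\<^sup>*" using gen p yz by blast
    then have "(y, z) \<in> E"
    proof (induction rule: rtrancl_induct)
      case base
      have "y \<in> space X" using Q p yz by (auto elim: equivE)
      then show ?case using E(1) by (auto elim!: equivE dest: refl_onD)
    next
      case (step z w)
      then have "(z, w) \<in> E" using E(2) by blast
      then show ?case using E(1) step.IH by (meson equivE transD)
    qed
    then show "p \<in> E" using yz by simp
  qed
  then show "generated_by X Q Q1 Q2" using Q sub unfolding generated_by_def by blast
qed

section \<open>The equivalence\<close>

theorem mainTheorem4:
  fixes X :: "'x measure"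
    and R :: "('x \<times> 'x) set"
    and A :: "('x, 'v, 'e) graph_field"
    and Eplus :: "'e set"
    and B :: "'x set"
    and s :: "'x \<Rightarrow> 'e"
  assumes "standard_borel X"
    and "borel_equiv_rel X R"
    and "countable_classes X R"
    and "borel_graph_field X R A"
    and "orientation R A Eplus"
    and "homogeneous X R (subfibred (edge_sp A) Eplus)"
    and "saturating_section X R (subfibred (edge_sp A) Eplus) B s"
    and "invariant_bipartition R (vert_sp A)
           (saturation R (vert_sp A) ((forg A \<circ> s) ` B))
           (saturation R (vert_sp A) ((ftrm A \<circ> s) ` B))"
  shows "arboretum X R A \<longleftrightarrow>
         amalgamated_product (restrict_space X B) (restrict_rel R B)
           (Stab R (vert_sp A) B (forg A \<circ> s))
           (Stab R (vert_sp A) B (ftrm A \<circ> s))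
           (Stab R (subfibred (edge_sp A) Eplus) B s)"
proof -
  let ?V = "vert_sp A" and ?E = "edge_sp A"
  let ?Q1 = "Stab R ?V B (forg A \<circ> s)" and ?Q2 = "Stab R ?V B (ftrm A \<circ> s)"
    and ?Q3 = "Stab R (subfibred ?E Eplus) B s"
  let ?I = "\<lambda>x. {y \<in> B. (x, y) \<in> R}" and ?\<epsilon> = "\<lambda>x y. fib_act ?E (x, y) (s y)"
  note R = assms(2)
  have V: "R_fibred_standard_space X R ?V" and E: "R_fibred_standard_space X R ?E"
    and serre: "serre_graph (total_graph A)"
    and mor_o: "fibred_morphism R ?E ?V (forg A)"
    and mor_t: "fibred_morphism R ?E ?V (ftrm A)"
    and mor_opp: "fibred_morphism R ?E ?E (fopp A)"
    using assms(4) by (auto simp: borel_graph_field_def)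
  have Eplus: "R_fibred_standard_space X R (subfibred ?E Eplus)"
    using assms(6) by (simp add: homogeneous_def)
  have s_plus: "partial_section X (subfibred ?E Eplus) B s"
    using assms(7) by (simp add: saturating_section_def)
  have s_meas: "s \<in> restrict_space X B \<rightarrow>\<^sub>M fib_space ?E"
    using s_plus by (auto simp: partial_section_def subfibred_def measurable_restrict_space2_iff)
  have s: "partial_section X ?E B s"
    using s_plus s_meas by (simp add: partial_section_def subfibred_def)
  note s_fibre = section_in_fibre[OF R E s]
  have sec: "partial_section X ?V B (h \<circ> s)" if "fibred_morphism R ?E ?V h" for h
    using s s_fibre that unfolding partial_section_def fibred_morphism_def
    by (auto simp: fibre_def intro: measurable_comp)
  note os = sec[OF mor_o] and ts = sec[OF mor_t]
  have B: "B \<subseteq> space X" using base_subset[OF R E s] .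
  then have spaceB: "space (restrict_space X B) = B" by (auto simp: space_restrict_space)
  \<comment> \<open>\<open>subfibred\<close> changes only the underlying space, while
    \<open>Stab\<close> sees only the action.\<close>
  have Q3: "?Q3 = Stab R ?E B s" by (simp add: Stab_def subfibred_def)
  \<comment> \<open>The saturating section and the orientation give \<open>edge_cover\<close>; the
    covering half of the bipartition gives \<open>vert_cover\<close>, and its disjointness gives
    \<open>bipartite\<close>.\<close>
  have coset: "coset_graph (fibre_graph A x) (?I x) (?\<epsilon> x) ?Q1 ?Q2 ?Q3" if x: "x \<in> space X" for x
  proof
    have \<epsilon>_fibre: "?\<epsilon> x y \<in> fibre ?E x" if "y \<in> ?I x" for y
      using act_fibre[OF R E s] s_fibre that by blast
    have org_\<epsilon>: "forg A (?\<epsilon> x y) = fib_act ?V (x, y) ((forg A \<circ> s) y)"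
      and trm_\<epsilon>: "ftrm A (?\<epsilon> x y) = fib_act ?V (x, y) ((ftrm A \<circ> s) y)" if "y \<in> ?I x" for y
      using mor_o mor_t s_fibre that by (auto simp: fibred_morphism_def)
    have \<epsilon>_cover: "\<exists>y\<in>?I x. a = ?\<epsilon> x y" if a: "a \<in> fibre ?E x" "a \<in> Eplus" for a
    proof -
      have "a \<in> space (fib_space (subfibred ?E Eplus))"
        using a by (auto simp: subfibred_def space_restrict_space fibre_def)
      then have "a \<in> saturation R (subfibred ?E Eplus) (s ` B)"
        using assms(7) by (simp add: saturating_section_def)
      then show ?thesis
        using a unfolding mem_saturation_section_iff[OF R Eplus s_plus]
        by (auto simp: subfibred_def fibre_def)
    qed
    show "serre_graph (fibre_graph A x)"
      using serre mor_o mor_t mor_opp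
      by (auto simp: serre_graph_def total_graph_def fibre_graph_def fibre_def fibred_morphism_def)
    show "?\<epsilon> x y \<in> edges (fibre_graph A x)" if "y \<in> ?I x" for y
      using \<epsilon>_fibre[OF that] by (simp add: fibre_graph_def)
    show "\<exists>y\<in>?I x. a = ?\<epsilon> x y \<or> a = opp (fibre_graph A x) (?\<epsilon> x y)"
      if "a \<in> edges (fibre_graph A x)" for a
    proof (cases "a \<in> Eplus")
      case True
      then show ?thesis using \<epsilon>_cover that by (auto simp: fibre_graph_def)
    next
      case False
      have a: "a \<in> fibre ?E x" using that by (simp add: fibre_graph_def)
      then have aE: "a \<in> space (fib_space ?E)" by (simp add: fibre_def)
      have "fopp A a \<in> Eplus" using assms(5) False aE by (auto simp: orientation_def)
      moreover have "fopp A a \<in> fibre ?E x"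
        using a aE mor_opp by (auto simp: fibre_def fibred_morphism_def dest: measurable_space)
      moreover have "fopp A (fopp A a) = a"
        using serre aE by (simp add: serre_graph_def total_graph_def)
      ultimately show ?thesis using \<epsilon>_cover by (fastforce simp: fibre_graph_def)
    qed
    show "\<exists>y\<in>?I x. v = org (fibre_graph A x) (?\<epsilon> x y) \<or> v = trm (fibre_graph A x) (?\<epsilon> x y)"
      if "v \<in> verts (fibre_graph A x)" for v
    proof -
      have v: "v \<in> space (fib_space ?V)" "fib_proj ?V v = x"
        using that by (auto simp: fibre_graph_def fibre_def)
      then consider "v \<in> saturation R ?V ((forg A \<circ> s) ` B)"
        | "v \<in> saturation R ?V ((ftrm A \<circ> s) ` B)"
        using assms(8) unfolding invariant_bipartition_def by blast
      then show ?thesis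
      proof cases
        case 1
        then obtain y where "y \<in> ?I x" "v = fib_act ?V (x, y) ((forg A \<circ> s) y)"
          using v unfolding mem_saturation_section_iff[OF R V os] by blast
        then show ?thesis using org_\<epsilon> by (auto simp: fibre_graph_def)
      next
        case 2
        then obtain y where "y \<in> ?I x" "v = fib_act ?V (x, y) ((ftrm A \<circ> s) y)"
          using v unfolding mem_saturation_section_iff[OF R V ts] by blast
        then show ?thesis using trm_\<epsilon> by (auto simp: fibre_graph_def)
      qed
    qed
    show "org (fibre_graph A x) (?\<epsilon> x y) \<noteq> trm (fibre_graph A x) (?\<epsilon> x z)"
      if y: "y \<in> ?I x" and z: "z \<in> ?I x" for y z
    proof
      let ?v = "forg A (?\<epsilon> x y)"
      assume "org (fibre_graph A x) (?\<epsilon> x y) = trm (fibre_graph A x) (?\<epsilon> x z)"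
      then have eq: "?v = ftrm A (?\<epsilon> x z)" by (simp add: fibre_graph_def)
      have v: "?v \<in> space (fib_space ?V)" "fib_proj ?V ?v = x"
        using mor_o \<epsilon>_fibre[OF y]
        by (auto simp: fibre_def fibred_morphism_def dest: measurable_space)
      have "?v \<in> saturation R ?V ((forg A \<circ> s) ` B)"
        using v y org_\<epsilon>[OF y] unfolding mem_saturation_section_iff[OF R V os] by auto
      moreover have "?v \<in> saturation R ?V ((ftrm A \<circ> s) ` B)"
        using v z trm_\<epsilon>[OF z] eq unfolding mem_saturation_section_iff[OF R V ts] by auto
      ultimately show False using assms(8) unfolding invariant_bipartition_def by blast
    qed
    show "(y, z) \<in> ?Q1 \<longleftrightarrow> z \<in> ?I x \<and>
        org (fibre_graph A x) (?\<epsilon> x y) = org (fibre_graph A x) (?\<epsilon> x z)" if "y \<in> ?I x" for y z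
      using Stab_iff[OF R V os, of x y z] that org_\<epsilon>[of y] org_\<epsilon>[of z]
      by (auto simp: fibre_graph_def)
    show "(y, z) \<in> ?Q2 \<longleftrightarrow> z \<in> ?I x \<and>
        trm (fibre_graph A x) (?\<epsilon> x y) = trm (fibre_graph A x) (?\<epsilon> x z)" if "y \<in> ?I x" for y z
      using Stab_iff[OF R V ts, of x y z] that trm_\<epsilon>[of y] trm_\<epsilon>[of z]
      by (auto simp: fibre_graph_def)
    show "(y, z) \<in> ?Q3 \<longleftrightarrow> z \<in> ?I x \<and> ?\<epsilon> x y = ?\<epsilon> x z" if "y \<in> ?I x" for y z
      using Stab_iff[OF R E s, of x y z] that unfolding Q3 by auto
  qed
  have verts: "verts (fibre_graph A x) \<noteq> {}" if "x \<in> space X" for x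
  proof -
    have "x \<in> fib_proj ?V ` space (fib_space ?V)"
      using V that by (simp add: R_fibred_standard_space_def fibred_standard_space_def)
    then show ?thesis by (auto simp: fibre_graph_def fibre_def)
  qed
  have "arboretum X R A \<longleftrightarrow> (\<forall>x\<in>space X. serre_tree (fibre_graph A x))"
    using assms(4) by (simp add: arboretum_def)
  also have "\<dots> \<longleftrightarrow> (\<forall>x\<in>space X. (\<forall>y\<in>?I x. \<forall>z\<in>?I x. (y, z) \<in> (?Q1 \<union> ?Q2)\<^sup>*) \<and>
      (\<forall>xs. reduced_tuple ?Q1 ?Q2 ?Q3 xs \<longrightarrow> hd xs \<in> ?I x \<longrightarrow> last xs \<noteq> hd xs))"
    by (intro ball_cong refl) (simp only: coset_graph.serre_tree_iff[OF coset] verts simp_thms)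
  finally have "arboretum X R A \<longleftrightarrow>
      (\<forall>x\<in>space X. \<forall>y\<in>?I x. \<forall>z\<in>?I x. (y, z) \<in> (?Q1 \<union> ?Q2)\<^sup>*) \<and>
      (\<forall>x\<in>space X. \<forall>xs. reduced_tuple ?Q1 ?Q2 ?Q3 xs \<longrightarrow> hd xs \<in> ?I x \<longrightarrow> last xs \<noteq> hd xs)"
    unfolding ball_conj_distrib .
  \<comment> \<open>To pass from the fibres to the whole relation, a pair is viewed in the fibre
    over its own first entry.\<close>
  moreover have "(\<forall>x\<in>space X. \<forall>y\<in>?I x. \<forall>z\<in>?I x. (y, z) \<in> (?Q1 \<union> ?Q2)\<^sup>*) \<longleftrightarrow>
      restrict_rel R B \<subseteq> (?Q1 \<union> ?Q2)\<^sup>*"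
  proof -
    have "(y, z) \<in> restrict_rel R B" if "y \<in> ?I x" "z \<in> ?I x" for x y z
    proof -
      have "(y, x) \<in> R" "(x, z) \<in> R" "y \<in> B" "z \<in> B"
        using that rel_sym[OF R E s, of x y] by auto
      then show ?thesis using rel_trans[OF R E s, of y x z] by (simp add: restrict_rel_def)
    qed
    moreover have "y \<in> space X \<and> y \<in> ?I y \<and> z \<in> ?I y" if "(y, z) \<in> restrict_rel R B" for y z
      using that subsetD[OF B, of y] rel_refl[OF R E s, of y] by (simp add: restrict_rel_def)
    ultimately show ?thesis by (meson subset_iff subrelI)
  qed
  \<comment> \<open>The head of a reduced tuple lies in \<open>B\<close>, because its first step is
    in a stabiliser; it can therefore serve as its own base point.\<close>
  moreover have "(\<forall>x\<in>space X. \<forall>xs. reduced_tuple ?Q1 ?Q2 ?Q3 xs \<longrightarrow> hd xs \<in> ?I x \<longrightarrow>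
        last xs \<noteq> hd xs) \<longleftrightarrow> (\<forall>xs. reduced_tuple ?Q1 ?Q2 ?Q3 xs \<longrightarrow> last xs \<noteq> hd xs)"
  proof -
    have "hd xs \<in> B" if red: "reduced_tuple ?Q1 ?Q2 ?Q3 xs" for xs
    proof -
      have "Suc 0 < length xs" using red by (auto simp: reduced_tuple_def)
      then have "(xs ! 0, xs ! Suc 0) \<in> ?Q1 \<union> ?Q2"
        using red unfolding reduced_tuple_def by (metis UnCI)
      then have "xs ! 0 \<in> B" by (auto simp: Stab_def)
      then show ?thesis using \<open>Suc 0 < length xs\<close> by (subst hd_conv_nth) auto
    qed
    then have "hd xs \<in> space X \<and> hd xs \<in> ?I (hd xs)" if "reduced_tuple ?Q1 ?Q2 ?Q3 xs" for xs
      using that B rel_refl[OF R E s] by blast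
    then show ?thesis by blast
  qed
  moreover have "amalgamated_product (restrict_space X B) (restrict_rel R B) ?Q1 ?Q2 ?Q3 \<longleftrightarrow>
      restrict_rel R B \<subseteq> (?Q1 \<union> ?Q2)\<^sup>* \<and>
      (\<forall>xs. reduced_tuple ?Q1 ?Q2 ?Q3 xs \<longrightarrow> last xs \<noteq> hd xs)"
  proof -
    have rel: "borel_equiv_rel (restrict_space X B) (restrict_rel R B)"
      using borel_equiv_rel_restrict[OF R E s] .
    have stab: "borel_equiv_rel (restrict_space X B) ?Q1"
      "borel_equiv_rel (restrict_space X B) ?Q2" "borel_equiv_rel (restrict_space X B) ?Q3"
      using borel_equiv_rel_Stab[OF R V os] borel_equiv_rel_Stab[OF R V ts]
        borel_equiv_rel_Stab[OF R E s] Q3 by simp_all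
    have sub: "?Q1 \<union> ?Q2 \<subseteq> restrict_rel R B" by (auto simp: Stab_def restrict_rel_def)
    \<comment> \<open>By equivariance of \<open>forg\<close> and \<open>ftrm\<close>, whatever
      carries one edge of the section to another also carries their ends to each other.\<close>
    have sub3: "?Q3 \<subseteq> ?Q1 \<and> ?Q3 \<subseteq> ?Q2"
    proof -
      have "forg A (s z) = fib_act ?V (z, y) (forg A (s y)) \<and>
          ftrm A (s z) = fib_act ?V (z, y) (ftrm A (s y))"
        if "y \<in> B" "(y, z) \<in> R" "fib_act ?E (z, y) (s y) = s z" for y z
        using that mor_o mor_t s_fibre[of y] rel_sym[OF R E s, of y z]
        unfolding fibred_morphism_def by metis
      then show ?thesis unfolding Q3 by (auto simp: Stab_def)
    qed
    have "generated_by (restrict_space X B) (restrict_rel R B) ?Q1 ?Q2 \<longleftrightarrow>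
        restrict_rel R B \<subseteq> (?Q1 \<union> ?Q2)\<^sup>*"
      using rel stab sub by (intro generated_by_iff) (simp_all add: borel_equiv_rel_def)
    then show ?thesis
      using rel stab sub sub3 unfolding amalgamated_product_def borel_subrelation_def by blast
  qed
  ultimately show ?thesis by blast
qed

end
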